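(* Let $B$ be a unital $C^*$-algebra and let $M\subset B$ be a unital subspace with $B=C^*(M)$. Let $\omega$ be a state on $B$ which is $M$-detectable. Let $\sigma:B\to B(H)$ denote the GNS representation of $\omega$. Then the following statements hold. (i) Let $\theta:B\to B(H)$ be a unital completely positive map that agrees with $\sigma$ on $M$. Then $\sigma$ is a subrepresentation of any Stinespring representation of $\theta$. (ii) $\sigma$ is a boundary representation for $M$.
   Context: A unital subspace is a complex linear subspace containing the unit; $C^*(M)$ is the $C^*$-algebra generated by $M$. States are unital contractive linear functionals. A state $\omega$ on $B$ is $M$-detectable if there is a bounded net $(x_\lambda)$ in $M$ such that $\omega(x_\lambda^*x_\lambda)=1$ for every $\lambda$, while for every state $\psi$ on $B$ distinct from $\omega$ there is $\mu$ such that $\psi(x_\lambda^*x_\lambda)<1$ whenever $\lambda\ge\mu$. A Stinespring representation of a unital completely positive map $\theta:B\to B(H)$ is a unital $*$-representation $\pi:B\to B(K)$ for which there is an isometry $V:H\to K$ with $\theta(b)=V^*\pi(b)V$ for all $b\in B$. "$\sigma$ is a subrepresentation of $\pi$" means that $\sigma$ is unitarily equivalent to the restriction of $\pi$ to a reducing subspace. A unital $*$-representation $\pi:B\to B(H)$ has the unique extension property with respect to $M$ if any unital completely positive map $\psi:B\to B(H)$ agreeing with $\pi$ on $M$ must agree with $\pi$ on all of $B$. If in addition $\pi$ is irreducible, $\pi$ is a boundary representation for $M$. *)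

theory Defs
  imports "HOL-Analysis.Analysis" "HOL-Library.Complex_Order"
begin

section \<open>Complex vector spaces\<close>

class complex_vector = real_vector +
  fixes scaleC :: "complex \<Rightarrow> 'a \<Rightarrow> 'a" (infixr "*\<^sub>C" 75)
  assumes scaleC_add_right: "c *\<^sub>C (x + y) = c *\<^sub>C x + c *\<^sub>C y"
    and scaleC_add_left: "(c + d) *\<^sub>C x = c *\<^sub>C x + d *\<^sub>C x"
    and scaleC_scaleC: "c *\<^sub>C (d *\<^sub>C x) = (c * d) *\<^sub>C x"
    and scaleR_scaleC: "r *\<^sub>R x = complex_of_real r *\<^sub>C x"

class complex_normed_vector = complex_vector + real_normed_vector +
  assumes norm_scaleC: "norm (c *\<^sub>C x) = cmod c * norm x"

instantiation complex :: complex_normed_vector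
begin
definition scaleC_complex :: "complex \<Rightarrow> complex \<Rightarrow> complex"
  where "scaleC_complex c z = c * z"
instance
  by standard (auto simp: scaleC_complex_def algebra_simps scaleR_conv_of_real norm_mult)
end

definition csubspace :: "'a::complex_vector set \<Rightarrow> bool" where
  "csubspace S \<longleftrightarrow> 0 \<in> S \<and> (\<forall>x\<in>S. \<forall>y\<in>S. x + y \<in> S) \<and> (\<forall>c. \<forall>x\<in>S. c *\<^sub>C x \<in> S)"

definition clinear :: "('a::complex_vector \<Rightarrow> 'b::complex_vector) \<Rightarrow> bool" where
  "clinear f \<longleftrightarrow> (\<forall>x y. f (x + y) = f x + f y) \<and> (\<forall>c x. f (c *\<^sub>C x) = c *\<^sub>C f x)"

definition bounded_clinear ::
  "('a::complex_normed_vector \<Rightarrow> 'b::complex_normed_vector) \<Rightarrow> bool" where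
  "bounded_clinear f \<longleftrightarrow> clinear f \<and> (\<exists>K. \<forall>x. norm (f x) \<le> K * norm x)"

section \<open>Unital C*-algebras and states\<close>

text \<open>The class \<^class>\<open>real_normed_algebra_1\<close> includes \<open>0 \<noteq> 1\<close>, so only the zero algebra, which
  has no states, is excluded.\<close>

class unital_cstar_algebra = complex_normed_vector + real_normed_algebra_1 + banach +
  fixes star :: "'a \<Rightarrow> 'a"
  assumes scaleC_mult_left: "(c *\<^sub>C x) * y = c *\<^sub>C (x * y)"
    and scaleC_mult_right: "x * (c *\<^sub>C y) = c *\<^sub>C (x * y)"
    and star_star: "star (star x) = x"
    and star_add: "star (x + y) = star x + star y"
    and star_scaleC: "star (c *\<^sub>C x) = cnj c *\<^sub>C star x"
    and star_mult: "star (x * y) = star y * star x"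
    and cstar_identity: "norm (star x * x) = (norm x)\<^sup>2"

instantiation complex :: unital_cstar_algebra
begin
definition star_complex :: "complex \<Rightarrow> complex" where "star_complex = cnj"
instance
  by standard (auto simp: scaleC_complex_def star_complex_def norm_mult power2_eq_square)
end

definition unital_subspace :: "'b::unital_cstar_algebra set \<Rightarrow> bool" where
  "unital_subspace M \<longleftrightarrow> csubspace M \<and> 1 \<in> M"

definition cstar_subalgebra :: "'b::unital_cstar_algebra set \<Rightarrow> bool" where
  "cstar_subalgebra A \<longleftrightarrow>
     csubspace A \<and> closed A \<and> (\<forall>x\<in>A. \<forall>y\<in>A. x * y \<in> A) \<and> (\<forall>x\<in>A. star x \<in> A)"

definition cstar_generated :: "'b::unital_cstar_algebra set \<Rightarrow> 'b set" where
  "cstar_generated M = \<Inter>{A. cstar_subalgebra A \<and> M \<subseteq> A}"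

definition state :: "('b::unital_cstar_algebra \<Rightarrow> complex) \<Rightarrow> bool" where
  "state \<omega> \<longleftrightarrow> clinear \<omega> \<and> \<omega> 1 = 1 \<and> (\<forall>b. cmod (\<omega> b) \<le> norm b)"

section \<open>Detectable states\<close>

definition directed_set :: "'i set \<Rightarrow> ('i \<Rightarrow> 'i \<Rightarrow> bool) \<Rightarrow> bool" where
  "directed_set D le \<longleftrightarrow> D \<noteq> {} \<and> (\<forall>i\<in>D. le i i) \<and>
     (\<forall>i\<in>D. \<forall>j\<in>D. \<forall>k\<in>D. le i j \<longrightarrow> le j k \<longrightarrow> le i k) \<and>
     (\<forall>i\<in>D. \<forall>j\<in>D. \<exists>k\<in>D. le i k \<and> le j k)"

text \<open>A definition in HOL cannot quantify over the type of the indices of a net, so this type is a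
  parameter. Detectability is only used as a hypothesis, and a statement that leaves \<open>'i\<close> free
  covers nets over arbitrary directed sets. The order on \<^typ>\<open>complex\<close> is that of
  \<^theory>\<open>HOL-Library.Complex_Order\<close>: \<open>z < 1\<close> says that \<open>z\<close> is real and less than \<open>1\<close>; states
  take real values on elements \<open>star x * x\<close>.\<close>

definition detectable ::
  "'i itself \<Rightarrow> 'b::unital_cstar_algebra set \<Rightarrow> ('b \<Rightarrow> complex) \<Rightarrow> bool" where
  "detectable (_ :: 'i itself) M \<omega> \<longleftrightarrow>
     (\<exists>(D :: 'i set) le (x :: 'i \<Rightarrow> 'b).
        directed_set D le \<and> (\<forall>i\<in>D. x i \<in> M) \<and> (\<exists>C. \<forall>i\<in>D. norm (x i) \<le> C) \<and>
        (\<forall>i\<in>D. \<omega> (star (x i) * x i) = 1) \<and>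
        (\<forall>\<psi>. state \<psi> \<and> \<psi> \<noteq> \<omega> \<longrightarrow>
           (\<exists>m\<in>D. \<forall>i\<in>D. le m i \<longrightarrow> \<psi> (star (x i) * x i) < 1)))"

section \<open>Hilbert spaces and representations\<close>

text \<open>The inner product is linear in its first argument. The axiom \<open>cinner_norm\<close> also says that
  it is positive definite.\<close>

class chilbert_space = complex_normed_vector + banach +
  fixes cinner :: "'a \<Rightarrow> 'a \<Rightarrow> complex"
  assumes cinner_add_left: "cinner (x + y) z = cinner x z + cinner y z"
    and cinner_scaleC_left: "cinner (c *\<^sub>C x) y = c * cinner x y"
    and cinner_commute: "cinner x y = cnj (cinner y x)"
    and cinner_norm: "cinner x x = complex_of_real ((norm x)\<^sup>2)"

instantiation complex :: chilbert_space
begin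
definition cinner_complex :: "complex \<Rightarrow> complex \<Rightarrow> complex" where "cinner_complex x y = x * cnj y"
instance
  by standard (auto simp: cinner_complex_def scaleC_complex_def algebra_simps
      complex_norm_square[symmetric])
end

definition adjoint_pair ::
  "('h::chilbert_space \<Rightarrow> 'k::chilbert_space) \<Rightarrow> ('k \<Rightarrow> 'h) \<Rightarrow> bool" where
  "adjoint_pair A A' \<longleftrightarrow> bounded_clinear A \<and> bounded_clinear A' \<and>
     (\<forall>x y. cinner (A x) y = cinner x (A' y))"

text \<open>Maps from a C*-algebra to the bounded operators on \<open>'h\<close> have type \<open>'b \<Rightarrow> 'h \<Rightarrow> 'h\<close>;
  boundedness of the values is part of \<open>linear_into_operators\<close>.\<close>

definition linear_into_operators ::
  "('b::unital_cstar_algebra \<Rightarrow> 'h::chilbert_space \<Rightarrow> 'h) \<Rightarrow> bool" where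
  "linear_into_operators \<theta> \<longleftrightarrow> (\<forall>b. bounded_clinear (\<theta> b)) \<and> (\<forall>h. clinear (\<lambda>b. \<theta> b h))"

definition unital_star_rep ::
  "('b::unital_cstar_algebra \<Rightarrow> 'h::chilbert_space \<Rightarrow> 'h) \<Rightarrow> bool" where
  "unital_star_rep \<pi> \<longleftrightarrow> linear_into_operators \<pi> \<and> \<pi> 1 = id \<and>
     (\<forall>a b. \<pi> (a * b) = \<pi> a \<circ> \<pi> b) \<and> (\<forall>b. adjoint_pair (\<pi> b) (\<pi> (star b)))"

definition gns_representation ::
  "('b::unital_cstar_algebra \<Rightarrow> complex) \<Rightarrow> ('b \<Rightarrow> 'h::chilbert_space \<Rightarrow> 'h) \<Rightarrow> bool" where
  "gns_representation \<omega> \<sigma> \<longleftrightarrow> unital_star_rep \<sigma> \<and>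
     (\<exists>\<xi>. closure (range (\<lambda>b. \<sigma> b \<xi>)) = UNIV \<and> (\<forall>b. \<omega> b = cinner (\<sigma> b \<xi>) \<xi>))"

section \<open>Completely positive maps and dilations\<close>

text \<open>The \<open>n \<times> n\<close> matrices are functions on indices below \<open>n\<close>. A positive element of the matrix
  algebra over a C*-algebra is one of the form \<open>a\<^sup>* a\<close>.\<close>

definition positive_matrix :: "nat \<Rightarrow> (nat \<Rightarrow> nat \<Rightarrow> 'b::unital_cstar_algebra) \<Rightarrow> bool" where
  "positive_matrix n b \<longleftrightarrow>
     (\<exists>a :: nat \<Rightarrow> nat \<Rightarrow> 'b. \<forall>i<n. \<forall>j<n. b i j = (\<Sum>k<n. star (a k i) * a k j))"

text \<open>Positivity of an operator matrix as an operator on the \<open>n\<close>-fold direct sum of \<open>'h\<close>.\<close>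

definition positive_operator_matrix ::
  "nat \<Rightarrow> (nat \<Rightarrow> nat \<Rightarrow> 'h::chilbert_space \<Rightarrow> 'h) \<Rightarrow> bool" where
  "positive_operator_matrix n T \<longleftrightarrow>
     (\<forall>h :: nat \<Rightarrow> 'h. 0 \<le> (\<Sum>i<n. cinner (\<Sum>j<n. T i j (h j)) (h i)))"

definition completely_positive ::
  "('b::unital_cstar_algebra \<Rightarrow> 'h::chilbert_space \<Rightarrow> 'h) \<Rightarrow> bool" where
  "completely_positive \<theta> \<longleftrightarrow> linear_into_operators \<theta> \<and>
     (\<forall>n b. positive_matrix n b \<longrightarrow> positive_operator_matrix n (\<lambda>i j. \<theta> (b i j)))"

definition ucp :: "('b::unital_cstar_algebra \<Rightarrow> 'h::chilbert_space \<Rightarrow> 'h) \<Rightarrow> bool" where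
  "ucp \<theta> \<longleftrightarrow> completely_positive \<theta> \<and> \<theta> 1 = id"

definition isometry :: "('h::chilbert_space \<Rightarrow> 'k::chilbert_space) \<Rightarrow> bool" where
  "isometry V \<longleftrightarrow> clinear V \<and> (\<forall>h. norm (V h) = norm h)"

text \<open>\<open>V'\<close> is the adjoint of \<open>V\<close>.\<close>

definition stinespring_representation ::
  "('b::unital_cstar_algebra \<Rightarrow> 'h::chilbert_space \<Rightarrow> 'h) \<Rightarrow>
   ('b \<Rightarrow> 'k::chilbert_space \<Rightarrow> 'k) \<Rightarrow> bool" where
  "stinespring_representation \<theta> \<pi> \<longleftrightarrow> unital_star_rep \<pi> \<and>
     (\<exists>V V'. isometry V \<and> adjoint_pair V V' \<and> (\<forall>b. \<theta> b = V' \<circ> \<pi> b \<circ> V))"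

section \<open>Subrepresentations and boundary representations\<close>

definition orthogonal_complement :: "'h::chilbert_space set \<Rightarrow> 'h set" where
  "orthogonal_complement L = {x. \<forall>y\<in>L. cinner x y = 0}"

definition reducing_subspace ::
  "('b::unital_cstar_algebra \<Rightarrow> 'h::chilbert_space \<Rightarrow> 'h) \<Rightarrow> 'h set \<Rightarrow> bool" where
  "reducing_subspace \<pi> L \<longleftrightarrow> csubspace L \<and> closed L \<and>
     (\<forall>b. \<pi> b ` L \<subseteq> L \<and> \<pi> b ` orthogonal_complement L \<subseteq> orthogonal_complement L)"

text \<open>The map \<open>U\<close> is a unitary operator from \<open>'h\<close> onto the Hilbert space \<open>L\<close>.\<close>

definition subrepresentation ::
  "('b::unital_cstar_algebra \<Rightarrow> 'h::chilbert_space \<Rightarrow> 'h) \<Rightarrow>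
   ('b \<Rightarrow> 'k::chilbert_space \<Rightarrow> 'k) \<Rightarrow> bool" where
  "subrepresentation \<sigma> \<pi> \<longleftrightarrow>
     (\<exists>L U. reducing_subspace \<pi> L \<and> isometry U \<and> range U = L \<and> (\<forall>b. U \<circ> \<sigma> b = \<pi> b \<circ> U))"

definition irreducible_rep ::
  "('b::unital_cstar_algebra \<Rightarrow> 'h::chilbert_space \<Rightarrow> 'h) \<Rightarrow> bool" where
  "irreducible_rep \<pi> \<longleftrightarrow> (UNIV :: 'h set) \<noteq> {0} \<and>
     (\<forall>L. reducing_subspace \<pi> L \<longrightarrow> L = {0} \<or> L = UNIV)"

definition unique_extension_property ::
  "'b::unital_cstar_algebra set \<Rightarrow> ('b \<Rightarrow> 'h::chilbert_space \<Rightarrow> 'h) \<Rightarrow> bool" where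
  "unique_extension_property M \<pi> \<longleftrightarrow> unital_star_rep \<pi> \<and>
     (\<forall>\<psi> :: 'b \<Rightarrow> 'h \<Rightarrow> 'h. ucp \<psi> \<and> (\<forall>x\<in>M. \<psi> x = \<pi> x) \<longrightarrow> \<psi> = \<pi>)"

definition boundary_representation ::
  "'b::unital_cstar_algebra set \<Rightarrow> ('b \<Rightarrow> 'h::chilbert_space \<Rightarrow> 'h) \<Rightarrow> bool" where
  "boundary_representation M \<pi> \<longleftrightarrow> unique_extension_property M \<pi> \<and> irreducible_rep \<pi>"

end

theory Submission
  imports Defs
begin

text \<open>
  Let \<open>\<xi>\<close> be the cyclic vector of \<open>\<sigma>\<close>. Everything follows from the unique extension property, and that
  property can be checked at \<open>\<xi>\<close> alone, without constructing any dilation.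

  Let \<open>\<theta>\<close> be a unital completely positive map that agrees with \<open>\<sigma>\<close> on \<open>M\<close>, and let \<open>\<psi>\<close> be its vector
  state at \<open>\<xi>\<close>. By the Schwarz inequality, \<open>\<psi> (x\<^sup>* x) \<ge> \<parallel>\<theta> x \<xi>\<parallel>\<^sup>2 = \<parallel>\<sigma> x \<xi>\<parallel>\<^sup>2 = \<omega> (x\<^sup>* x)\<close> for all \<open>x\<close> in
  \<open>M\<close>, so along a detecting net \<open>\<psi>\<close> never drops below \<open>1\<close>; hence \<open>\<psi> = \<omega>\<close>. Now suppose that
  \<open>\<theta> b \<xi> = \<sigma> b \<xi>\<close> for some \<open>b\<close>. Then \<open>\<parallel>\<theta> b \<xi>\<parallel>\<^sup>2 = \<omega> (b\<^sup>* b) = \<psi> (b\<^sup>* b)\<close>, so the Schwarz inequality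
  is an equality at \<open>b\<close> and \<open>\<xi>\<close>. As for multiplicative domains, this forces
  \<open>\<theta> (c b) \<xi> = \<theta> c (\<theta> b \<xi>)\<close> for every \<open>c\<close> (lemma \<open>ucp_multiplicative_at\<close>). For \<open>c\<close> or \<open>c\<^sup>*\<close> in \<open>M\<close>
  the right-hand side is \<open>\<sigma> (c b) \<xi>\<close>. So the closed subspace of all \<open>b\<close> with \<open>\<theta> b \<xi> = \<sigma> b \<xi>\<close>, which
  contains \<open>1\<close>, is invariant under left multiplication by the C*-algebra that \<open>M\<close> generates: it is the
  whole algebra. The multiplicativity then gives \<open>\<theta> c (\<sigma> b \<xi>) = \<sigma> c (\<sigma> b \<xi>)\<close> for all \<open>b\<close>
  and \<open>c\<close>, and \<open>\<theta> = \<sigma>\<close> because \<open>\<xi>\<close> is cyclic (lemma \<open>ucp_eq_rep_if_vector_states_eq\<close>).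

  The claim on Stinespring representations of \<open>\<theta>\<close> thereby reduces to Stinespring representations \<open>\<pi>\<close> of \<open>\<sigma>\<close> itself, with isometry \<open>V\<close>. There \<open>V\<^sup>*\<close>
  preserves the norm of each \<open>\<pi> b (V h)\<close>, so these vectors lie in the range of \<open>V\<close>, and \<open>V\<close> intertwines
  \<open>\<sigma>\<close> with the restriction of \<open>\<pi>\<close> to its range.

  For irreducibility, a reducing subspace splits \<open>\<xi>\<close> into orthogonal components. If both were nonzero,
  \<open>\<omega>\<close> would be a proper convex combination of their normalized vector states, neither of which is \<open>\<omega>\<close>;
  far out in a detecting net both are below \<open>1\<close> while \<open>\<omega>\<close> equals \<open>1\<close>.

  The analytic input is the fact that a positive functional \<open>\<phi>\<close> is bounded by \<open>\<phi> 1\<close>, so that vector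
  functionals are states. It rests on square roots of \<open>1 - h\<close>, given by the binomial series.
\<close>

section \<open>Positive semidefinite forms of two variables\<close>

text \<open>The common source of the Cauchy-Schwarz inequalities below. The hypothesis is what the positivity of
  a form at \<open>z *\<^sub>C u + w *\<^sub>C v\<close> says about its four values at \<open>u\<close> and \<open>v\<close>. Stated for the
  numbers alone, it also covers \<open>u\<close> and \<open>v\<close> from a tensor product that is never constructed.\<close>

lemma positive_hermitian_form_2x2:
  fixes p q r s :: complex
  assumes pos: "\<And>z w. 0 \<le> z * cnj z * p + z * cnj w * q + w * cnj z * r + w * cnj w * s"
  shows "r = cnj q" and "0 \<le> p" and "0 \<le> s" and "(cmod q)\<^sup>2 \<le> Re p * Re s"
proof -
  show p: "0 \<le> p" using pos[of 1 0] by simp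
  show s: "0 \<le> s" using pos[of 0 1] by simp
  show r: "r = cnj q"
    using pos[of 1 1] pos[of "\<i>" 1] p s by (auto simp: less_eq_complex_def complex_eq_iff)
  \<comment> \<open>The phase of \<open>z = - t * cnj q\<close> makes both mixed terms negative, leaving a real quadratic in \<open>t\<close>.\<close>
  have quad: "0 \<le> t\<^sup>2 * (cmod q)\<^sup>2 * Re p - 2 * t * (cmod q)\<^sup>2 + Re s" for t :: real
  proof -
    have "0 \<le> Re (of_real (t\<^sup>2) * (q * cnj q) * p - 2 * of_real t * (q * cnj q) + s)"
      using pos[of "- (of_real t * cnj q)" 1] r
      by (simp add: less_eq_complex_def algebra_simps power2_eq_square)
    also have "\<dots> = t\<^sup>2 * (cmod q)\<^sup>2 * Re p - 2 * t * (cmod q)\<^sup>2 + Re s"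
      unfolding complex_norm_square[symmetric] by (simp flip: of_real_mult of_real_power)
    finally show ?thesis .
  qed
  show "(cmod q)\<^sup>2 \<le> Re p * Re s"
  proof (cases "Re p = 0")
    case True
    have "(cmod q)\<^sup>2 = 0"
    proof (rule ccontr)
      assume "(cmod q)\<^sup>2 \<noteq> 0"
      then show False
        using quad[of "(Re s + 1) / (2 * (cmod q)\<^sup>2)"] True by (simp add: field_simps)
    qed
    then show ?thesis using True by simp
  next
    case False
    then have "0 < Re p" using p by (simp add: less_eq_complex_def)
    then show ?thesis using quad[of "1 / Re p"] by (simp add: field_simps power2_eq_square)
  qed
qed

section \<open>Complex linear maps\<close>

lemma scaleC_one [simp]: "1 *\<^sub>C x = (x :: 'a::complex_vector)"
  using scaleR_scaleC[of 1 x] by simp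

lemma scaleC_minus_one: "(- 1) *\<^sub>C x = - (x :: 'a::complex_vector)"
  using scaleR_scaleC[of "- 1" x] by simp

lemma scaleC_zero [simp]: "0 *\<^sub>C x = (0 :: 'a::complex_vector)"
  using scaleR_scaleC[of 0 x] by simp

lemma
  assumes "clinear f"
  shows clinear_add: "f (x + y) = f x + f y" and clinear_scaleC: "f (c *\<^sub>C x) = c *\<^sub>C f x"
    and clinear_zero: "f 0 = 0" and clinear_minus: "f (- x) = - f x"
    and clinear_diff: "f (x - y) = f x - f y" and clinear_scaleR: "f (a *\<^sub>R x) = a *\<^sub>R f x"
proof -
  show a: "f (x + y) = f x + f y" for x y using assms by (simp add: clinear_def)
  show s: "f (c *\<^sub>C x) = c *\<^sub>C f x" for c x using assms by (simp add: clinear_def)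
  show z: "f 0 = 0" using s[of 0 0] by simp
  show m: "f (- x) = - f x" for x using s[of "-1" x] by (simp add: scaleC_minus_one)
  show "f (x - y) = f x - f y" using a[of x "- y"] m by simp
  show "f (a *\<^sub>R x) = a *\<^sub>R f x" by (simp add: scaleR_scaleC s)
qed

lemma scaleC_zero_right [simp]: "c *\<^sub>C 0 = (0 :: 'a::complex_vector)"
  using scaleC_add_right[of c 0 0] by simp

lemma scaleC_diff_right: "c *\<^sub>C (x - y) = c *\<^sub>C x - c *\<^sub>C (y :: 'a::complex_vector)"
  using scaleC_add_right[of c "x - y" y] by simp

lemma clinear_bounded_linear:
  assumes "clinear f" and "\<And>x. norm (f x) \<le> C * norm x"
  shows "bounded_linear f"
  by (rule bounded_linear_intro[where K = C])
    (use assms in \<open>auto simp: clinear_add clinear_scaleR mult.commute\<close>)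

section \<open>Hilbert spaces\<close>

lemma cinner_add_right: "cinner x (y + z) = cinner x y + cinner x (z :: 'h::chilbert_space)"
  by (subst (1 2 3) cinner_commute) (simp add: cinner_add_left)

lemma cinner_scaleC_right: "cinner x (c *\<^sub>C y) = cnj c * cinner x (y :: 'h::chilbert_space)"
  by (subst (1 2) cinner_commute) (simp add: cinner_scaleC_left)

lemma cinner_zero_left [simp]: "cinner 0 y = 0"
  using cinner_scaleC_left[of 0 0 y] by simp
lemma cinner_zero_right [simp]: "cinner x 0 = 0"
  using cinner_scaleC_right[of x 0 0] by simp
lemma cinner_minus_left: "cinner (- x) y = - cinner x y"
  using cinner_scaleC_left[of "-1" x y] by (simp add: scaleC_minus_one)
lemma cinner_minus_right: "cinner x (- y) = - cinner x y"
  using cinner_scaleC_right[of x "-1" y] by (simp add: scaleC_minus_one)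
lemma cinner_diff_left: "cinner (x - y) z = cinner x z - cinner y z"
  using cinner_add_left[of x "- y" z] by (simp add: cinner_minus_left)
lemma cinner_diff_right: "cinner x (y - z) = cinner x y - cinner x z"
  using cinner_add_right[of x y "- z"] by (simp add: cinner_minus_right)

lemmas cinner_sesquilinear = cinner_add_left cinner_add_right cinner_diff_left cinner_diff_right
  cinner_scaleC_left cinner_scaleC_right cinner_minus_left cinner_minus_right

lemma norm_square_cinner: "(norm x)\<^sup>2 = Re (cinner x x)"
  by (simp add: cinner_norm)

lemma cinner_eq_0_commute: "cinner x y = 0 \<longleftrightarrow> cinner y x = 0"
  by (metis cinner_commute complex_cnj_zero_iff)

lemma cinner_Cauchy_Schwarz: "cmod (cinner x y) \<le> norm x * norm (y :: 'h::chilbert_space)"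
proof -
  have "0 \<le> z * cnj z * cinner x x + z * cnj w * cinner x y + w * cnj z * cinner y x
      + w * cnj w * cinner y y" for z w
  proof -
    have "0 \<le> cinner (z *\<^sub>C x + w *\<^sub>C y) (z *\<^sub>C x + w *\<^sub>C y)"
      by (simp add: cinner_norm less_eq_complex_def)
    then show ?thesis by (simp add: cinner_sesquilinear algebra_simps)
  qed
  then have "(cmod (cinner x y))\<^sup>2 \<le> (norm x)\<^sup>2 * (norm y)\<^sup>2"
    using positive_hermitian_form_2x2(4) unfolding norm_square_cinner by metis
  then show ?thesis
    by (metis mult_nonneg_nonneg norm_ge_zero power2_le_imp_le power_mult_distrib)
qed

lemma bounded_linear_cinner_left: "bounded_linear (\<lambda>x. cinner x y)"
proof (rule bounded_linear_intro)
  show "norm (cinner x y) \<le> norm x * norm y" for x by (rule cinner_Cauchy_Schwarz)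
qed (simp_all add: cinner_add_left scaleR_scaleC cinner_scaleC_left scaleR_conv_of_real scaleC_complex_def)

lemma closed_orthogonal_complement: "closed (orthogonal_complement L)"
proof -
  have "orthogonal_complement L = (\<Inter>y\<in>L. (\<lambda>x. cinner x y) -` {0})"
    by (auto simp: orthogonal_complement_def)
  moreover have "closed ((\<lambda>x. cinner x y) -` {0})" for y :: 'a
    by (intro continuous_closed_vimage closed_singleton linear_continuous_at
        bounded_linear_cinner_left)
  ultimately show ?thesis by (simp add: closed_INT)
qed

lemma closed_superset_of_dense:
  "closure S = UNIV \<Longrightarrow> closed T \<Longrightarrow> S \<subseteq> T \<Longrightarrow> T = (UNIV :: 'a::topological_space set)"
  by (metis closure_minimal top.extremum_uniqueI)

lemma orthogonal_to_dense_eq_0: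
  assumes "closure S = UNIV" and "\<And>s. s \<in> S \<Longrightarrow> cinner s x = 0"
  shows "x = 0"
proof -
  have "orthogonal_complement {x} = UNIV"
    using assms by (intro closed_superset_of_dense[OF _ closed_orthogonal_complement])
      (auto simp: orthogonal_complement_def)
  then have "cinner x x = 0" by (auto simp: orthogonal_complement_def)
  then show ?thesis by (simp add: cinner_norm)
qed

lemma cinner_eqI: "(\<And>z. cinner x z = cinner y z) \<Longrightarrow> x = (y :: 'h::chilbert_space)"
proof -
  assume "\<And>z. cinner x z = cinner y z"
  then have "cinner (x - y) (x - y) = 0" by (simp add: cinner_diff_left)
  then show ?thesis by (simp add: cinner_norm)
qed

lemma norm_diff_square:
  "(norm (x - y))\<^sup>2 = (norm x)\<^sup>2 + (norm y)\<^sup>2 - 2 * Re (cinner x (y :: 'h::chilbert_space))"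
proof -
  have "Re (cinner y x) = Re (cinner x y)" by (subst cinner_commute) simp
  then show ?thesis by (simp add: norm_square_cinner cinner_sesquilinear)
qed

lemma parallelogram:
  "(norm (x + y))\<^sup>2 + (norm (x - y))\<^sup>2 = 2 * (norm x)\<^sup>2 + 2 * (norm (y :: 'h::chilbert_space))\<^sup>2"
  by (simp add: norm_square_cinner cinner_sesquilinear)

text \<open>The point of \<open>L\<close> closest to \<open>x\<close> exists because, by the parallelogram law, minimizing sequences are
  Cauchy. The difference is orthogonal to \<open>L\<close>, since otherwise a small step within \<open>L\<close> would
  decrease the distance.\<close>

lemma orthogonal_decomposition:
  fixes L :: "'h::chilbert_space set"
  assumes L: "csubspace L" and "closed L"
  obtains y z where "x = y + z" and "y \<in> L" and "z \<in> orthogonal_complement L"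
proof -
  have ne: "L \<noteq> {}" using L by (auto simp: csubspace_def)
  define d where "d = infdist x L"
  have dmin: "d \<le> norm (x - y)" if "y \<in> L" for y
    using infdist_le[OF that, of x] by (simp add: d_def dist_norm)
  have d0: "0 \<le> d" by (simp add: d_def infdist_nonneg)
  have "\<exists>y\<in>L. (norm (x - y))\<^sup>2 < d\<^sup>2 + e" if "e > 0" for e
  proof -
    have "d < sqrt (d\<^sup>2 + e)" using that d0 by (simp add: real_less_rsqrt)
    then obtain y where "y \<in> L" "norm (x - y) < sqrt (d\<^sup>2 + e)"
      using ne cInf_lessD[of "dist x ` L"] by (auto simp: d_def infdist_def dist_norm)
    then have "(norm (x - y))\<^sup>2 < (sqrt (d\<^sup>2 + e))\<^sup>2" by (intro power_strict_mono) auto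
    then show ?thesis using \<open>y \<in> L\<close> that by auto
  qed
  then have "\<forall>n. \<exists>y\<in>L. (norm (x - y))\<^sup>2 < d\<^sup>2 + 1 / Suc n" by simp
  then obtain u where uL: "\<And>n. u n \<in> L" and u: "\<And>n. (norm (x - u n))\<^sup>2 < d\<^sup>2 + 1 / Suc n"
    by metis
  have close: "(norm (u m - u n))\<^sup>2 \<le> 2 / Suc m + 2 / Suc n" for m n
  proof -
    \<comment> \<open>The midpoint lies in \<open>L\<close>, so its distance from \<open>x\<close> is at least \<open>d\<close>.\<close>
    have "(1/2) *\<^sub>R (u m + u n) \<in> L"
      using L uL unfolding csubspace_def scaleR_scaleC by blast
    then have "d\<^sup>2 \<le> (norm (x - (1/2) *\<^sub>R (u m + u n)))\<^sup>2"
      using dmin d0 by (simp add: power_mono)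
    also have "x - (1/2) *\<^sub>R (u m + u n) = (1/2) *\<^sub>R ((x - u m) + (x - u n))"
      by (simp add: algebra_simps flip: scaleR_add_left)
    finally have "4 * d\<^sup>2 \<le> (norm ((x - u m) + (x - u n)))\<^sup>2"
      by (simp add: power_divide)
    then show ?thesis
      using parallelogram[of "x - u m" "x - u n"] u[of m] u[of n]
      by (simp add: norm_minus_commute)
  qed
  have "Cauchy u"
  proof (rule metric_CauchyI)
    fix e :: real assume "e > 0"
    then obtain N where N: "4 / e\<^sup>2 < real N" using reals_Archimedean2 by blast
    have "dist (u m) (u n) < e" if "m \<ge> N" "n \<ge> N" for m n
    proof -
      have "(norm (u m - u n))\<^sup>2 \<le> 2 / Suc N + 2 / Suc N"
        using close[of m n] that
        by (smt (verit) divide_left_mono mult_pos_pos of_nat_0_less_iff of_nat_mono Suc_le_mono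
            zero_less_Suc)
      also have "\<dots> = 4 / Suc N" by (simp flip: add_divide_distrib)
      also have "\<dots> < e\<^sup>2"
      proof -
        have "4 < real N * e\<^sup>2" and "0 < e\<^sup>2" using N \<open>e > 0\<close> by (simp_all add: field_simps)
        moreover have "e\<^sup>2 * real (Suc N) = e\<^sup>2 + real N * e\<^sup>2" by (simp add: algebra_simps)
        ultimately have "4 < e\<^sup>2 * real (Suc N)" by linarith
        then show ?thesis by (simp add: pos_divide_less_eq)
      qed
      finally show ?thesis using \<open>e > 0\<close> by (simp add: dist_norm power2_less_imp_less)
    qed
    then show "\<exists>N. \<forall>m\<ge>N. \<forall>n\<ge>N. dist (u m) (u n) < e" by blast
  qed
  then obtain y where lim: "u \<longlonglongrightarrow> y" using Cauchy_convergent convergent_def by blast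
  have y: "y \<in> L" using \<open>closed L\<close> uL lim closed_sequentially by blast
  have "(\<lambda>n. d\<^sup>2 + 1 / real (Suc n)) \<longlonglongrightarrow> d\<^sup>2 + 0"
    by (intro tendsto_add tendsto_const LIMSEQ_inverse_real_of_nat[unfolded inverse_eq_divide])
  moreover have "(\<lambda>n. (norm (x - u n))\<^sup>2) \<longlonglongrightarrow> (norm (x - y))\<^sup>2" by (intro tendsto_intros lim)
  ultimately have "(norm (x - y))\<^sup>2 \<le> d\<^sup>2"
    using u by (intro LIMSEQ_le[of "\<lambda>n. (norm (x - u n))\<^sup>2"]) (auto intro: less_imp_le)
  then have best: "(norm (x - y))\<^sup>2 \<le> (norm (x - y'))\<^sup>2" if "y' \<in> L" for y'
    using dmin[OF that] d0 by (smt (verit) power_mono)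
  have "cinner (x - y) z = 0" if z: "z \<in> L" for z
  proof -
    define q where "q = cinner (x - y) z"
    have quad: "0 \<le> t\<^sup>2 * (cmod q)\<^sup>2 * (norm z)\<^sup>2 - 2 * t * (cmod q)\<^sup>2" for t :: real
    proof -
      have "y + (of_real t * q) *\<^sub>C z \<in> L" using L y z by (auto simp: csubspace_def)
      from best[OF this] have "(norm (x - y))\<^sup>2 \<le> (norm ((x - y) - (of_real t * q) *\<^sub>C z))\<^sup>2"
        by (simp add: algebra_simps)
      also have "\<dots> = (norm (x - y))\<^sup>2 + t\<^sup>2 * (cmod q)\<^sup>2 * (norm z)\<^sup>2 - 2 * t * (cmod q)\<^sup>2"
        unfolding norm_diff_square
        by (simp add: norm_scaleC norm_mult power_mult_distrib cinner_scaleC_right mult.assoc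
            mult.commute[of "cnj q"] complex_norm_square[symmetric] flip: q_def of_real_mult of_real_power)
      finally show ?thesis by simp
    qed
    \<comment> \<open>The step \<open>1 / n\<close> is so small that the linear term dominates; adding \<open>1\<close> covers \<open>z = 0\<close>.\<close>
    define n where "n = (norm z)\<^sup>2 + 1"
    have "n \<ge> 1" by (simp add: n_def)
    have "0 \<le> n\<^sup>2 * ((1 / n)\<^sup>2 * (cmod q)\<^sup>2 * (n - 1) - 2 * (1 / n) * (cmod q)\<^sup>2)"
      using quad[of "1 / n"] unfolding n_def by (intro mult_nonneg_nonneg) simp_all
    also have "\<dots> = - ((n + 1) * (cmod q)\<^sup>2)"
      using \<open>n \<ge> 1\<close> by (simp add: field_simps power2_eq_square)
    finally have "(n + 1) * (cmod q)\<^sup>2 \<le> 0" by simp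
    then show ?thesis using \<open>n \<ge> 1\<close> by (simp add: mult_le_0_iff q_def)
  qed
  then show thesis using that[of y "x - y"] y by (auto simp: orthogonal_complement_def)
qed

section \<open>Boundedness of positive functionals\<close>

lemma norm_star [simp]: "norm (star b) = norm (b :: 'b::unital_cstar_algebra)"
proof -
  have le: "norm b \<le> norm (star b)" for b :: 'b
  proof (cases "b = 0")
    case False
    have "norm b * norm b \<le> norm (star b) * norm b"
      using cstar_identity[of b] norm_mult_ineq[of "star b" b] by (simp add: power2_eq_square)
    then show ?thesis using False by simp
  qed simp
  show ?thesis using le[of b] le[of "star b"] by (simp add: star_star)
qed

lemma bounded_linear_star: "bounded_linear (star :: 'b::unital_cstar_algebra \<Rightarrow> 'b)"
  by (rule bounded_linear_intro[where K = 1]) (simp_all add: star_add scaleR_scaleC star_scaleC)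

lemma star_minus: "star (- b) = - star (b :: 'b::unital_cstar_algebra)"
  using bounded_linear_star by (rule linear_neg[OF bounded_linear.linear])

lemma star_zero [simp]: "star 0 = (0 :: 'b::unital_cstar_algebra)"
  using bounded_linear_star by (rule linear_0[OF bounded_linear.linear])

lemma star_one [simp]: "star 1 = (1 :: 'b::unital_cstar_algebra)"
  by (metis mult.left_neutral mult.right_neutral star_mult star_star)

text \<open>The root is the binomial series of \<open>(1 - h) powr (1/2)\<close>. It converges absolutely for
  \<open>norm h < 1\<close>, it squares to \<open>1 - h\<close> by the Vandermonde identity for the coefficients of the Cauchy
  product, and it is self-adjoint because its partial sums are.\<close>

lemma square_root_one_minus:
  fixes h :: "'b::unital_cstar_algebra"
  assumes "norm h < 1" and h: "star h = h"
  shows "\<exists>c. star c = c \<and> c * c = 1 - h"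
proof -
  define a where "a n = ((1/2 :: real) gchoose n) *\<^sub>R (- h) ^ n" for n
  have abs: "summable (\<lambda>n. norm (a n))"
  proof (rule summable_comparison_test)
    have "summable (\<lambda>n. norm ((((1/2 :: real) gchoose n)) * norm h ^ n))"
      using assms(1) by (intro abs_summable_in_conv_radius) (simp add: conv_radius_gchoose)
    then show "summable (\<lambda>n. norm (((1/2 :: real) gchoose n) * norm h ^ n))" .
    show "\<exists>N. \<forall>n\<ge>N. norm (norm (a n)) \<le> norm (((1/2 :: real) gchoose n) * norm h ^ n)"
      using norm_power_ineq[of "- h"] by (auto simp: a_def abs_mult intro!: mult_left_mono)
  qed
  have star_power: "star (h ^ n) = h ^ n" for n
    by (induction n) (simp_all add: star_mult h power_commutes)
  have "star (a n) = a n" for n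
    using star_power by (cases "even n") (simp_all add: a_def scaleR_scaleC star_scaleC star_minus)
  then have self: "star (suminf a) = suminf a"
    using bounded_linear.suminf[OF bounded_linear_star summable_norm_cancel[OF abs]] by simp
  have conv: "(\<Sum>i\<le>n. a i * a (n - i)) = (1 gchoose n) *\<^sub>R (- h) ^ n" for n
  proof -
    have "(\<Sum>i\<le>n. a i * a (n - i)) = (\<Sum>i\<le>n. ((1/2 gchoose i) * (1/2 gchoose (n - i))) *\<^sub>R (- h) ^ n)"
      by (intro sum.cong) (auto simp: a_def simp flip: power_add)
    also have "\<dots> = (1 gchoose n) *\<^sub>R (- h) ^ n"
      using gbinomial_Vandermonde[of "1/2::real" "1/2" n]
      by (simp add: atMost_atLeast0 flip: scaleR_sum_left)
    finally show ?thesis .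
  qed
  have "suminf a * suminf a = (\<Sum>n. (1 gchoose n) *\<^sub>R (- h) ^ n)"
    using Cauchy_product[OF abs abs] by (simp add: conv)
  also have "\<dots> = (\<Sum>n\<in>{0,1}. (1 gchoose n) *\<^sub>R (- h) ^ n)"
  proof (rule suminf_finite)
    show "(1 gchoose n) *\<^sub>R (- h) ^ n = 0" if "n \<notin> {0, 1}" for n
    proof -
      have "1 < n" using that by auto
      then show ?thesis using binomial_gbinomial[of 1 n, where ?'a = real] by (simp add: binomial_eq_0)
    qed
  qed simp
  also have "\<dots> = 1 - h" by simp
  finally show ?thesis using self by blast
qed

definition positive_functional :: "('b::unital_cstar_algebra \<Rightarrow> complex) \<Rightarrow> bool" where
  "positive_functional \<phi> \<longleftrightarrow> clinear \<phi> \<and> (\<forall>b. 0 \<le> \<phi> (star b * b))"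

lemma positive_functional_one: "positive_functional \<phi> \<Longrightarrow> 0 \<le> \<phi> 1"
  unfolding positive_functional_def by (metis mult_1_left star_one)

text \<open>This is the Cauchy-Schwarz inequality for the form \<open>(a, b) \<mapsto> \<phi> (star b * a)\<close> at \<open>1\<close> and \<open>b\<close>.\<close>

lemma positive_functional_Cauchy_Schwarz:
  assumes "positive_functional \<phi>"
  shows "(cmod (\<phi> b))\<^sup>2 \<le> Re (\<phi> 1) * Re (\<phi> (star b * b))"
proof -
  have lin: "clinear \<phi>" using assms by (simp add: positive_functional_def)
  have "0 \<le> z * cnj z * \<phi> 1 + z * cnj w * \<phi> (star b) + w * cnj z * \<phi> b
      + w * cnj w * \<phi> (star b * b)" for z w
  proof -
    have "0 \<le> \<phi> (star (z *\<^sub>C 1 + w *\<^sub>C b) * (z *\<^sub>C 1 + w *\<^sub>C b))"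
      using assms by (simp add: positive_functional_def)
    then show ?thesis
      by (simp add: star_add star_scaleC distrib_left distrib_right scaleC_mult_left
          scaleC_mult_right scaleC_scaleC clinear_add[OF lin] clinear_scaleC[OF lin]
          scaleC_complex_def mult_ac add_ac)
  qed
  from positive_hermitian_form_2x2[OF this] show ?thesis by simp
qed

text \<open>On the open unit ball \<open>1 - star b * b\<close> has the form \<open>star c * c\<close>, so positivity gives
  \<open>\<phi> (star b * b) \<le> \<phi> 1\<close>, and the Cauchy-Schwarz inequality gives the bound; scaling does the rest.\<close>

lemma positive_functional_bound:
  assumes \<phi>: "positive_functional \<phi>"
  shows "cmod (\<phi> b) \<le> Re (\<phi> 1) * norm b"
proof -
  have lin: "clinear \<phi>" using assms by (simp add: positive_functional_def)
  define p where "p = Re (\<phi> 1)"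
  have p: "0 \<le> p" using positive_functional_one[OF \<phi>] by (simp add: p_def less_eq_complex_def)
  have unit_ball: "cmod (\<phi> b) \<le> p" if "norm b < 1" for b
  proof -
    have "norm (star b * b) < 1" using that by (simp add: cstar_identity power_less_one_iff)
    moreover have "star (star b * b) = star b * b" by (simp add: star_mult star_star)
    ultimately obtain c where "star c = c" "c * c = 1 - star b * b"
      using square_root_one_minus by blast
    then have "0 \<le> \<phi> (1 - star b * b)" using \<phi> by (metis positive_functional_def)
    then have "Re (\<phi> (star b * b)) \<le> p"
      by (simp add: clinear_diff[OF lin] p_def less_eq_complex_def)
    then have "(cmod (\<phi> b))\<^sup>2 \<le> p\<^sup>2"
      using positive_functional_Cauchy_Schwarz[OF \<phi>, of b] p
      by (smt (verit) mult_left_mono p_def power2_eq_square)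
    then show ?thesis using p by (simp add: power2_le_iff_abs_le)
  qed
  have "cmod (\<phi> b) \<le> p * norm b + e" if "e > 0" for e
  proof -
    \<comment> \<open>Slightly more than \<open>norm b\<close>, so that \<open>b / r\<close> lies in the open ball; \<open>p + 1\<close> avoids division by \<open>0\<close>.\<close>
    define r where "r = norm b + e / (p + 1)"
    have r: "norm b < r" using p that by (simp add: r_def)
    then have r0: "0 < r" by (rule le_less_trans[OF norm_ge_zero])
    have "cmod (\<phi> ((1 / r) *\<^sub>R b)) \<le> p" using r r0 by (intro unit_ball) simp
    then have "cmod (\<phi> b) \<le> p * r" using r0 by (simp add: clinear_scaleR[OF lin] field_simps)
    also have "\<dots> \<le> p * norm b + e" using p that by (simp add: r_def field_simps)
    finally show ?thesis .
  qed
  then show ?thesis unfolding p_def by (rule field_le_epsilon)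
qed

lemma state_if_positive_functional: "positive_functional \<phi> \<Longrightarrow> \<phi> 1 = 1 \<Longrightarrow> state \<phi>"
  using positive_functional_bound[of \<phi>] by (auto simp: state_def positive_functional_def)

section \<open>Representations\<close>

lemma
  assumes "linear_into_operators \<theta>"
  shows linear_into_operators_clinear: "clinear (\<theta> b)"
    and linear_into_operators_clinear_algebra: "clinear (\<lambda>b. \<theta> b h)"
    and linear_into_operators_bounded_linear: "bounded_linear (\<theta> b)"
proof -
  have b: "bounded_clinear (\<theta> b)" and l: "clinear (\<lambda>b. \<theta> b h)"
    using assms by (auto simp: linear_into_operators_def)
  show "clinear (\<theta> b)" and "clinear (\<lambda>b. \<theta> b h)" using b l by (auto simp: bounded_clinear_def)
  show "bounded_linear (\<theta> b)"
    using b clinear_bounded_linear unfolding bounded_clinear_def by blast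
qed

lemma clinear_vector_functional:
  assumes "linear_into_operators \<theta>"
  shows "clinear (\<lambda>b. cinner (\<theta> b h) k)"
  using linear_into_operators_clinear_algebra[OF assms, of h]
  by (simp add: clinear_def cinner_add_left cinner_scaleC_left scaleC_complex_def)

lemma star_rep_adjoint:
  "unital_star_rep \<pi> \<Longrightarrow> cinner (\<pi> b x) y = cinner x (\<pi> (star b) y)"
  by (simp add: unital_star_rep_def adjoint_pair_def)

lemma star_rep_inner:
  assumes "unital_star_rep \<pi>"
  shows "cinner (\<pi> b x) (\<pi> c y) = cinner (\<pi> (star c * b) x) y"
proof -
  have "cinner (\<pi> (star c) (\<pi> b x)) y = cinner (\<pi> b x) (\<pi> c y)"
    by (simp add: star_rep_adjoint[OF assms] star_star)
  then show ?thesis using assms by (simp add: unital_star_rep_def)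
qed

lemma star_rep_positive_functional:
  assumes "unital_star_rep \<pi>"
  shows "positive_functional (\<lambda>b. cinner (\<pi> b x) x)"
proof -
  have "cinner (\<pi> (star b * b) x) x = of_real ((norm (\<pi> b x))\<^sup>2)" for b
    using star_rep_inner[OF assms, of b x b x] by (simp add: cinner_norm)
  then have "0 \<le> cinner (\<pi> (star b * b) x) x" for b by (simp add: less_eq_complex_def)
  then show ?thesis
    using assms clinear_vector_functional[of \<pi> x x]
    by (simp add: positive_functional_def unital_star_rep_def)
qed

lemma star_rep_norm_square:
  assumes "unital_star_rep \<pi>"
  shows "(norm (\<pi> b x))\<^sup>2 = Re (cinner (\<pi> (star b * b) x) x)"
  by (simp add: norm_square_cinner star_rep_inner[OF assms])

section \<open>Completely positive maps\<close>

lemma cinner_sum_left: "cinner (\<Sum>i\<in>A. f i) y = (\<Sum>i\<in>A. cinner (f i) y)"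
  by (induction A rule: infinite_finite_induct) (simp_all add: cinner_add_left)

text \<open>Complete positivity enters through the matrices \<open>star (b i) * b j\<close>. The sum is
  the squared norm of \<open>\<Sum>i<n. b i \<otimes> h i\<close> in the Stinespring space of \<open>\<theta>\<close>, so the form replaces that space.\<close>

lemma completely_positive_form:
  fixes n :: nat
  assumes "completely_positive \<theta>"
  shows "0 \<le> (\<Sum>i<n. \<Sum>j<n. cinner (\<theta> (star (b i) * b j) (h j)) (h i))"
proof -
  have "positive_matrix n (\<lambda>i j. star (b i) * b j)"
  proof -
    \<comment> \<open>The factor has the \<open>b j\<close> as its first row and zeros elsewhere.\<close>
    define a where "a k j = (if k = 0 then b j else 0)" for k j :: nat
    have "star (b i) * b j = (\<Sum>k<n. star (a k i) * a k j)" if "i < n" for i j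
    proof -
      have "(\<Sum>k<n. star (a k i) * a k j) = (\<Sum>k<n. if k = 0 then star (b i) * b j else 0)"
        by (intro sum.cong) (auto simp: a_def)
      then show ?thesis using that by simp
    qed
    then show ?thesis unfolding positive_matrix_def by blast
  qed
  then have "positive_operator_matrix n (\<lambda>i j. \<theta> (star (b i) * b j))"
    using assms by (simp add: completely_positive_def)
  then show ?thesis unfolding positive_operator_matrix_def by (simp add: cinner_sum_left)
qed

lemma completely_positive_positive_functional:
  assumes "completely_positive \<theta>"
  shows "positive_functional (\<lambda>b. cinner (\<theta> b h) h)"
  using assms completely_positive_form[OF assms, where n = 1 and b = "\<lambda>_. _" and h = "\<lambda>_. h"]
    clinear_vector_functional[of \<theta> h h]
  by (simp add: positive_functional_def completely_positive_def)

text \<open>The two inner products are conjugate off-diagonal entries of the form at \<open>1 \<otimes> h\<close> and \<open>b \<otimes> k\<close>.\<close>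

lemma completely_positive_adjoint:
  assumes "completely_positive \<theta>"
  shows "cinner (\<theta> b k) h = cinner k (\<theta> (star b) h)"
proof -
  have lin: "clinear (\<theta> c)" for c
    using assms by (simp add: completely_positive_def linear_into_operators_clinear)
  have "0 \<le> z * cnj z * cinner (\<theta> 1 h) h + z * cnj w * cinner (\<theta> (star b) h) k
      + w * cnj z * cinner (\<theta> b k) h + w * cnj w * cinner (\<theta> (star b * b) k) k" for z w
    using completely_positive_form[OF assms, where n = 2 and b = "\<lambda>i. if i = 0 then 1 else b"
        and h = "\<lambda>i. if i = 0 then z *\<^sub>C h else w *\<^sub>C k"]
    by (simp add: numeral_2_eq_2 clinear_scaleC[OF lin] cinner_sesquilinear mult_ac add_ac)
  from positive_hermitian_form_2x2(1)[OF this] show ?thesis by (simp flip: cinner_commute)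
qed

text \<open>In terms of the Stinespring space, the defect \<open>u = b \<otimes> h - 1 \<otimes> \<theta> b h\<close> has squared norm
  \<open>Re (cinner (\<theta> (star b * b) h) h) - (norm (\<theta> b h))\<^sup>2\<close>, and its inner product with \<open>star c \<otimes> k\<close>
  is \<open>cinner (\<theta> (c * b) h - \<theta> c (\<theta> b h)) k\<close>. The claims are the positivity of the form at \<open>u\<close> and
  the Cauchy-Schwarz inequality for \<open>u\<close> and \<open>star c \<otimes> k\<close>.\<close>

lemma ucp_defect:
  assumes "ucp \<theta>"
  shows ucp_Schwarz: "(norm (\<theta> b h))\<^sup>2 \<le> Re (cinner (\<theta> (star b * b) h) h)"
    and ucp_multiplicative_defect:
      "(cmod (cinner (\<theta> (c * b) h - \<theta> c (\<theta> b h)) k))\<^sup>2 \<le>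
       (Re (cinner (\<theta> (star b * b) h) h) - (norm (\<theta> b h))\<^sup>2) * Re (cinner (\<theta> (c * star c) k) k)"
proof -
  have cp: "completely_positive \<theta>" and one: "\<theta> 1 = id" using assms by (auto simp: ucp_def)
  have lin: "clinear (\<theta> c)" for c
    using cp by (simp add: completely_positive_def linear_into_operators_clinear)
  have adj: "cinner (\<theta> (star b) (\<theta> b h)) h = cinner (\<theta> b h) (\<theta> b h)"
    by (simp add: completely_positive_adjoint[OF cp] star_star)
  define p where "p = cinner (\<theta> (star b * b) h) h - cinner (\<theta> b h) (\<theta> b h)"
  define r where "r = cinner (\<theta> (star b * star c) k) h - cinner (\<theta> (star c) k) (\<theta> b h)"
  have "0 \<le> z * cnj z * p + z * cnj w * cinner (\<theta> (c * b) h - \<theta> c (\<theta> b h)) k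
      + w * cnj z * r + w * cnj w * cinner (\<theta> (c * star c) k) k" for z w
    using completely_positive_form[OF cp, where n = 3
        and b = "\<lambda>i. if i = 0 then b else if i = 1 then 1 else star c"
        and h = "\<lambda>i. if i = 0 then z *\<^sub>C h else if i = 1 then - (z *\<^sub>C \<theta> b h) else w *\<^sub>C k"]
    by (simp add: numeral_3_eq_3 clinear_scaleC[OF lin] clinear_minus[OF lin] one cinner_sesquilinear
        star_star adj p_def r_def algebra_simps)
  from positive_hermitian_form_2x2(2,4)[OF this]
  show "(norm (\<theta> b h))\<^sup>2 \<le> Re (cinner (\<theta> (star b * b) h) h)"
    and "(cmod (cinner (\<theta> (c * b) h - \<theta> c (\<theta> b h)) k))\<^sup>2 \<le>
       (Re (cinner (\<theta> (star b * b) h) h) - (norm (\<theta> b h))\<^sup>2) * Re (cinner (\<theta> (c * star c) k) k)"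
    by (simp_all add: p_def norm_square_cinner less_eq_complex_def)
qed

text \<open>A version of the multiplicative domain for a single vector: equality in the Schwarz inequality means
  that the defect vector of \<open>b\<close> and \<open>h\<close> vanishes.\<close>

lemma ucp_multiplicative_at:
  assumes "ucp \<theta>" and "(norm (\<theta> b h))\<^sup>2 = Re (cinner (\<theta> (star b * b) h) h)"
  shows "\<theta> (c * b) h = \<theta> c (\<theta> b h)"
proof (rule cinner_eqI)
  fix k
  show "cinner (\<theta> (c * b) h) k = cinner (\<theta> c (\<theta> b h)) k"
    using ucp_multiplicative_defect[OF assms(1), of c b h k] assms(2) by (simp add: cinner_diff_left)
qed

text \<open>The elements \<open>b\<close> at which \<open>\<theta> b \<xi> = \<sigma> b \<xi>\<close> form a closed subspace \<open>S\<close> containing \<open>1\<close>. As the vector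
  functionals agree, the Schwarz inequality is an equality on \<open>S\<close>, so \<open>\<theta>\<close> is multiplicative there. The
  elements that, together with their adjoints, multiply \<open>S\<close> into itself form a C*-subalgebra
  containing \<open>M\<close>, hence everything.\<close>

lemma ucp_eq_rep_if_vector_states_eq:
  fixes \<theta> \<sigma> :: "'b::unital_cstar_algebra \<Rightarrow> 'h::chilbert_space \<Rightarrow> 'h"
  assumes \<theta>: "ucp \<theta>" and \<sigma>: "unital_star_rep \<sigma>"
    and agree: "\<And>x. x \<in> M \<Longrightarrow> \<theta> x = \<sigma> x"
    and gen: "cstar_generated M = UNIV"
    and cyclic: "closure (range (\<lambda>b. \<sigma> b \<xi>)) = UNIV"
    and same: "\<And>b. cinner (\<theta> b \<xi>) \<xi> = cinner (\<sigma> b \<xi>) \<xi>"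
  shows "\<theta> = \<sigma>"
proof -
  have cp: "completely_positive \<theta>" and l\<theta>: "linear_into_operators \<theta>" and one: "\<theta> 1 = id"
    using \<theta> by (auto simp: ucp_def completely_positive_def)
  have l\<sigma>: "linear_into_operators \<sigma>" and one': "\<sigma> 1 = id" and mult: "\<And>a b. \<sigma> (a * b) = \<sigma> a \<circ> \<sigma> b"
    using \<sigma> by (auto simp: unital_star_rep_def)
  define f where "f b = \<theta> b \<xi> - \<sigma> b \<xi>" for b
  define S where "S = f -` {0}"
  \<comment> \<open>Norm bounds, which make \<open>f\<close> continuous and \<open>S\<close> closed.\<close>
  have le: "norm (\<theta> b \<xi>) \<le> norm (\<sigma> b \<xi>)" for b
    using ucp_Schwarz[OF \<theta>, of b \<xi>] star_rep_norm_square[OF \<sigma>, of b \<xi>]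
    by (simp add: same power2_le_imp_le)
  have norm_\<sigma>: "norm (\<sigma> b \<xi>) \<le> norm \<xi> * norm b" for b
  proof -
    have "(norm (\<sigma> b \<xi>))\<^sup>2 \<le> cmod (cinner (\<sigma> (star b * b) \<xi>) \<xi>)"
      by (simp add: star_rep_norm_square[OF \<sigma>] complex_Re_le_cmod)
    also have "\<dots> \<le> (norm \<xi> * norm b)\<^sup>2"
      using positive_functional_bound[OF star_rep_positive_functional[OF \<sigma>, of \<xi>], of "star b * b"]
      by (simp add: one' norm_square_cinner cstar_identity power_mult_distrib)
    finally show ?thesis by (simp add: power2_le_iff_abs_le)
  qed
  have f_lin: "clinear f"
    using linear_into_operators_clinear_algebra[OF l\<theta>, of \<xi>]
      linear_into_operators_clinear_algebra[OF l\<sigma>, of \<xi>]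
    by (simp add: clinear_def f_def scaleC_diff_right)
  have "norm (f b) \<le> (2 * norm \<xi>) * norm b" for b
    using norm_triangle_ineq4[of "\<theta> b \<xi>" "\<sigma> b \<xi>"] le[of b] norm_\<sigma>[of b] by (simp add: f_def)
  then have "bounded_linear f" by (rule clinear_bounded_linear[OF f_lin])
  then have S_closed: "closed S"
    unfolding S_def by (intro continuous_closed_vimage closed_singleton linear_continuous_at)
  have S_mult: "\<theta> (c * b) \<xi> = \<theta> c (\<sigma> b \<xi>)" if "b \<in> S" for b c
    using that ucp_multiplicative_at[OF \<theta>, of b \<xi> c]
    by (simp add: S_def f_def same star_rep_norm_square[OF \<sigma>])
  have S_left: "c * b \<in> S" if "b \<in> S" "\<theta> c = \<sigma> c" for b c
    using S_mult[of b c] that by (simp add: S_def f_def mult)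
  define A where "A = {a. \<forall>b\<in>S. a * b \<in> S \<and> star a * b \<in> S}"
  have "cstar_subalgebra A"
  proof -
    have S0: "0 \<in> S" and S_add: "x + y \<in> S" and S_scale: "c *\<^sub>C x \<in> S"
      if "x \<in> S" "y \<in> S" for x y c
      using that by (auto simp: S_def clinear_zero[OF f_lin] clinear_add[OF f_lin] clinear_scaleC[OF f_lin])
    have "closed A"
    proof -
      have "A = (\<Inter>b\<in>S. (\<lambda>a. a * b) -` S \<inter> (\<lambda>a. star a * b) -` S)" by (auto simp: A_def)
      moreover have "closed ((\<lambda>a. a * b) -` S \<inter> (\<lambda>a. star a * b) -` S)" for b
        by (intro closed_Int continuous_closed_vimage S_closed linear_continuous_at
            bounded_linear_mult_left bounded_linear_compose[OF bounded_linear_mult_left bounded_linear_star])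
      ultimately show ?thesis by (simp add: closed_INT)
    qed
    moreover have "csubspace A"
      using S0 S_add S_scale
      by (auto simp: csubspace_def A_def distrib_right star_add star_scaleC scaleC_mult_left)
    ultimately show ?thesis
      by (auto simp: cstar_subalgebra_def A_def star_mult star_star mult.assoc)
  qed
  moreover have "M \<subseteq> A"
  proof -
    have "\<theta> (star x) = \<sigma> (star x)" if "x \<in> M" for x
    proof (rule ext, rule cinner_eqI)
      fix h k
      have "cinner (\<theta> (star x) h) k = cinner h (\<theta> x k)"
        by (simp add: completely_positive_adjoint[OF cp] star_star)
      also have "\<dots> = cinner (\<sigma> (star x) h) k"
        using agree[OF that] by (simp add: star_rep_adjoint[OF \<sigma>] star_star)
      finally show "cinner (\<theta> (star x) h) k = cinner (\<sigma> (star x) h) k" .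
    qed
    then show ?thesis using S_left agree by (auto simp: A_def)
  qed
  ultimately have "A = UNIV" using gen by (auto simp: cstar_generated_def)
  then have "b * 1 \<in> S" if "1 \<in> S" for b using that unfolding A_def by blast
  moreover have "1 \<in> S" by (simp add: S_def f_def one one')
  ultimately have S_UNIV: "b \<in> S" for b by simp
  show "\<theta> = \<sigma>"
  proof
    fix c
    have "closed {h. \<theta> c h = \<sigma> c h}"
      by (intro closed_Collect_eq linear_continuous_on linear_into_operators_bounded_linear l\<theta> l\<sigma>)
    moreover have "range (\<lambda>b. \<sigma> b \<xi>) \<subseteq> {h. \<theta> c h = \<sigma> c h}"
    proof clarify
      fix b
      have "\<theta> c (\<sigma> b \<xi>) = \<theta> (c * b) \<xi>" using S_mult[OF S_UNIV] by simp
      also have "\<dots> = \<sigma> (c * b) \<xi>" using S_UNIV[of "c * b"] by (simp add: S_def f_def)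
      finally show "\<theta> c (\<sigma> b \<xi>) = \<sigma> c (\<sigma> b \<xi>)" by (simp add: mult)
    qed
    ultimately have "{h. \<theta> c h = \<sigma> c h} = UNIV" by (rule closed_superset_of_dense[OF cyclic])
    then show "\<theta> c = \<sigma> c" by auto
  qed
qed

section \<open>Detectable states and their representations\<close>

lemma detectable_dominates:
  assumes det: "detectable TYPE('i) M \<omega>" and "state \<psi>"
    and dom: "\<And>x. x \<in> M \<Longrightarrow> Re (\<omega> (star x * x)) \<le> Re (\<psi> (star x * x))"
  shows "\<psi> = \<omega>"
proof (rule ccontr)
  assume "\<psi> \<noteq> \<omega>"
  obtain D :: "'i set" and le x where dir: "directed_set D le" and x: "\<forall>i\<in>D. x i \<in> M"
    and peak: "\<forall>i\<in>D. \<omega> (star (x i) * x i) = 1"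
    and below: "\<forall>\<psi>. state \<psi> \<and> \<psi> \<noteq> \<omega> \<longrightarrow> (\<exists>m\<in>D. \<forall>i\<in>D. le m i \<longrightarrow> \<psi> (star (x i) * x i) < 1)"
    using det unfolding detectable_def by blast
  obtain m where "m \<in> D" "\<forall>i\<in>D. le m i \<longrightarrow> \<psi> (star (x i) * x i) < 1"
    using below \<open>state \<psi>\<close> \<open>\<psi> \<noteq> \<omega>\<close> by blast
  moreover have "le m m" using dir \<open>m \<in> D\<close> by (simp add: directed_set_def)
  ultimately have "\<psi> (star (x m) * x m) < 1" by blast
  then show False using dom[of "x m"] x peak \<open>m \<in> D\<close> by (simp add: less_complex_def)
qed

text \<open>Detectable states are extreme: far out in a detecting net, \<open>\<phi>\<close> and \<open>\<psi>\<close> are both below \<open>1\<close>, and so is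
  every convex combination.\<close>

lemma detectable_extreme:
  assumes det: "detectable TYPE('i) M \<omega>" and "state \<phi>" and "state \<psi>" and "\<phi> \<noteq> \<omega>" and "\<psi> \<noteq> \<omega>"
    and s: "s > 0" and t: "t > 0" and st: "s + t = 1"
  shows "\<omega> \<noteq> (\<lambda>b. of_real s * \<phi> b + of_real t * \<psi> b)"
proof
  assume convex: "\<omega> = (\<lambda>b. of_real s * \<phi> b + of_real t * \<psi> b)"
  obtain D :: "'i set" and le x where dir: "directed_set D le"
    and peak: "\<forall>i\<in>D. \<omega> (star (x i) * x i) = 1"
    and below: "\<forall>\<psi>. state \<psi> \<and> \<psi> \<noteq> \<omega> \<longrightarrow> (\<exists>m\<in>D. \<forall>i\<in>D. le m i \<longrightarrow> \<psi> (star (x i) * x i) < 1)"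
    using det unfolding detectable_def by blast
  obtain m where m: "m \<in> D" "\<forall>i\<in>D. le m i \<longrightarrow> \<phi> (star (x i) * x i) < 1"
    using below \<open>state \<phi>\<close> \<open>\<phi> \<noteq> \<omega>\<close> by blast
  obtain n where n: "n \<in> D" "\<forall>i\<in>D. le n i \<longrightarrow> \<psi> (star (x i) * x i) < 1"
    using below \<open>state \<psi>\<close> \<open>\<psi> \<noteq> \<omega>\<close> by blast
  obtain i where i: "i \<in> D" "le m i" "le n i"
    using dir m(1) n(1) unfolding directed_set_def by blast
  let ?y = "star (x i) * x i"
  have "Re (\<omega> ?y) = s * Re (\<phi> ?y) + t * Re (\<psi> ?y)" by (simp add: convex)
  moreover have "Re (\<omega> ?y) = 1" using peak i(1) by simp
  moreover have "s * Re (\<phi> ?y) < s * 1" using m(2) i s by (intro mult_strict_left_mono) (auto simp: less_complex_def)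
  moreover have "t * Re (\<psi> ?y) < t * 1" using n(2) i t by (intro mult_strict_left_mono) (auto simp: less_complex_def)
  ultimately show False using st by simp
qed

lemma gns_unit_vector:
  assumes "state \<omega>" and "unital_star_rep \<sigma>" and "\<And>b. \<omega> b = cinner (\<sigma> b \<xi>) \<xi>"
  shows "(norm \<xi>)\<^sup>2 = 1"
  using assms by (metis id_apply norm_square_cinner one_complex.sel(1) state_def unital_star_rep_def)

text \<open>The Schwarz inequality at the cyclic vector \<open>\<xi>\<close> makes the vector state of \<open>\<theta>\<close> dominate \<open>\<omega>\<close> on the
  squares \<open>star x * x\<close> with \<open>x\<close> in \<open>M\<close>, so detectability forces the two states to coincide.\<close>

lemma detectable_gns_unique_extension:
  fixes \<sigma> :: "'b::unital_cstar_algebra \<Rightarrow> 'h::chilbert_space \<Rightarrow> 'h"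
  assumes gen: "cstar_generated M = UNIV"
    and \<omega>: "state \<omega>" and det: "detectable TYPE('i) M \<omega>" and gns: "gns_representation \<omega> \<sigma>"
    and \<theta>: "ucp \<theta>" and agree: "\<And>x. x \<in> M \<Longrightarrow> \<theta> x = \<sigma> x"
  shows "\<theta> = \<sigma>"
proof -
  obtain \<xi> where \<sigma>: "unital_star_rep \<sigma>" and cyclic: "closure (range (\<lambda>b. \<sigma> b \<xi>)) = UNIV"
    and vec: "\<And>b. \<omega> b = cinner (\<sigma> b \<xi>) \<xi>"
    using gns by (auto simp: gns_representation_def)
  define \<psi> where "\<psi> b = cinner (\<theta> b \<xi>) \<xi>" for b
  have "state \<psi>" unfolding \<psi>_def
    using \<theta> gns_unit_vector[OF \<omega> \<sigma> vec]
    by (intro state_if_positive_functional completely_positive_positive_functional)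
      (auto simp: ucp_def cinner_norm)
  then have "\<psi> = \<omega>"
  proof (rule detectable_dominates[OF det])
    fix x assume "x \<in> M"
    then have "Re (\<omega> (star x * x)) = (norm (\<theta> x \<xi>))\<^sup>2"
      by (simp add: agree vec star_rep_norm_square[OF \<sigma>])
    also have "\<dots> \<le> Re (\<psi> (star x * x))" unfolding \<psi>_def by (rule ucp_Schwarz[OF \<theta>])
    finally show "Re (\<omega> (star x * x)) \<le> Re (\<psi> (star x * x))" .
  qed
  then have "cinner (\<theta> b \<xi>) \<xi> = cinner (\<sigma> b \<xi>) \<xi>" for b
    by (metis \<psi>_def vec)
  then show ?thesis
    by (intro ucp_eq_rep_if_vector_states_eq[OF \<theta> \<sigma> _ gen cyclic]) (auto simp: agree)
qed

text \<open>A reducing subspace \<open>L\<close> with \<open>\<xi> = \<eta> + \<zeta>\<close> along \<open>L\<close> and its complement makes \<open>\<omega>\<close> a convex combination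
  of the vector states of \<open>\<eta>\<close> and \<open>\<zeta>\<close>. If either of them were \<open>\<omega>\<close>, cyclicity would make that
  component a multiple of \<open>\<xi>\<close>, which is impossible while both are nonzero. So one component
  vanishes, and \<open>L\<close> or its complement contains the cyclic vector.\<close>

lemma detectable_gns_irreducible:
  fixes \<sigma> :: "'b::unital_cstar_algebra \<Rightarrow> 'h::chilbert_space \<Rightarrow> 'h"
  assumes \<omega>: "state \<omega>" and det: "detectable TYPE('i) M \<omega>" and gns: "gns_representation \<omega> \<sigma>"
  shows "irreducible_rep \<sigma>"
proof -
  obtain \<xi> where \<sigma>: "unital_star_rep \<sigma>" and cyclic: "closure (range (\<lambda>b. \<sigma> b \<xi>)) = UNIV"
    and vec: "\<And>b. \<omega> b = cinner (\<sigma> b \<xi>) \<xi>"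
    using gns by (auto simp: gns_representation_def)
  have one: "\<sigma> 1 = id" and lin: "clinear (\<sigma> b)" for b
    using \<sigma> by (auto simp: unital_star_rep_def linear_into_operators_clinear)
  have unit: "(norm \<xi>)\<^sup>2 = 1" by (rule gns_unit_vector[OF \<omega> \<sigma> vec])
  have "L = {0} \<or> L = UNIV" if red: "reducing_subspace \<sigma> L" for L
  proof -
    have L: "csubspace L" "closed L" and inv: "\<And>b x. x \<in> L \<Longrightarrow> \<sigma> b x \<in> L"
      and inv': "\<And>b x. x \<in> orthogonal_complement L \<Longrightarrow> \<sigma> b x \<in> orthogonal_complement L"
      using red unfolding reducing_subspace_def by blast+
    obtain \<eta> \<zeta> where \<xi>: "\<xi> = \<eta> + \<zeta>" and \<eta>: "\<eta> \<in> L" and \<zeta>: "\<zeta> \<in> orthogonal_complement L"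
      using orthogonal_decomposition[OF L] by blast
    have orth: "cinner y x = 0" "cinner x y = 0" if "x \<in> L" "y \<in> orthogonal_complement L" for x y
      using that cinner_eq_0_commute by (auto simp: orthogonal_complement_def)
    show ?thesis
    proof (cases "\<eta> = 0 \<or> \<zeta> = 0")
      case True
      then show ?thesis
      proof
        assume "\<eta> = 0"
        then have "range (\<lambda>b. \<sigma> b \<xi>) \<subseteq> orthogonal_complement L" using \<xi> \<zeta> inv' by auto
        then have all: "orthogonal_complement L = UNIV"
          by (rule closed_superset_of_dense[OF cyclic closed_orthogonal_complement])
        have "x = 0" if "x \<in> L" for x
          using orth(1)[OF that, of x] all by (simp add: cinner_norm)
        then show ?thesis using L(1) by (auto simp: csubspace_def)
      next
        assume "\<zeta> = 0"
        then have "range (\<lambda>b. \<sigma> b \<xi>) \<subseteq> L" using \<xi> \<eta> inv by auto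
        then show ?thesis using closed_superset_of_dense[OF cyclic L(2)] by simp
      qed
    next
      case False
      define s t where "s = (norm \<eta>)\<^sup>2" and "t = (norm \<zeta>)\<^sup>2"
      have s: "s > 0" and t: "t > 0" using False by (auto simp: s_def t_def)
      define vector_state where "vector_state x b = cinner (\<sigma> b x) x / of_real ((norm x)\<^sup>2)" for x :: 'h and b
      have state_vector_state: "state (vector_state x)" if "x \<noteq> 0" for x
      proof (rule state_if_positive_functional)
        show "positive_functional (vector_state x)"
          using star_rep_positive_functional[OF \<sigma>, of x]
          by (auto simp: positive_functional_def clinear_def vector_state_def add_divide_distrib scaleC_complex_def
              less_eq_complex_def)
        show "vector_state x 1 = 1" using that by (simp add: vector_state_def one cinner_norm)
      qed
      have split: "cinner (\<sigma> b \<xi>) \<eta> = cinner (\<sigma> b \<eta>) \<eta>" "cinner (\<sigma> b \<xi>) \<zeta> = cinner (\<sigma> b \<zeta>) \<zeta>" for b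
        using orth[OF \<eta> inv'[OF \<zeta>]] orth[OF inv[OF \<eta>] \<zeta>] by (auto simp: \<xi> clinear_add[OF lin] cinner_add_left)
      have convex: "\<omega> = (\<lambda>b. of_real s * vector_state \<eta> b + of_real t * vector_state \<zeta> b)"
      proof
        fix b
        have "\<omega> b = cinner (\<sigma> b \<eta>) \<eta> + cinner (\<sigma> b \<zeta>) \<zeta>"
          using split by (simp add: vec \<xi> cinner_add_right)
        then show "\<omega> b = of_real s * vector_state \<eta> b + of_real t * vector_state \<zeta> b"
          using s t by (simp add: vector_state_def s_def t_def)
      qed
      have "of_real (s + t) = (1 :: complex)"
        using fun_cong[OF convex, of 1] \<omega> state_vector_state[of \<eta>] state_vector_state[of \<zeta>] False
        by (simp add: state_def)
      then have st: "s + t = 1" using of_real_eq_1_iff by blast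
      \<comment> \<open>A component with vector state \<open>\<omega>\<close> has the same inner products as \<open>(norm x)\<^sup>2 *\<^sub>R \<xi>\<close> with \<open>\<sigma> b \<xi>\<close>.\<close>
      have multiple: "x = (norm x)\<^sup>2 *\<^sub>R \<xi>"
        if "vector_state x = \<omega>" "x \<noteq> 0" "\<And>b. cinner (\<sigma> b \<xi>) x = cinner (\<sigma> b x) x" for x
      proof -
        have "x - (norm x)\<^sup>2 *\<^sub>R \<xi> = 0"
        proof (rule orthogonal_to_dense_eq_0[OF cyclic])
          fix v assume "v \<in> range (\<lambda>b. \<sigma> b \<xi>)"
          then obtain b where v: "v = \<sigma> b \<xi>" by blast
          have "cinner v x = of_real ((norm x)\<^sup>2) * cinner v \<xi>"
            using fun_cong[OF that(1), of b] that(2,3) by (simp add: v vec vector_state_def field_simps)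
          then show "cinner v (x - (norm x)\<^sup>2 *\<^sub>R \<xi>) = 0"
            by (simp add: cinner_diff_right scaleR_scaleC cinner_scaleC_right)
        qed
        then show ?thesis by simp
      qed
      have nonzero: "cinner \<xi> \<eta> \<noteq> 0" "cinner \<xi> \<zeta> \<noteq> 0"
        using False orth[OF \<eta> \<zeta>] by (auto simp: \<xi> cinner_add_left cinner_norm)
      have "vector_state \<eta> \<noteq> \<omega>"
      proof
        assume "vector_state \<eta> = \<omega>"
        then have "cinner \<eta> \<zeta> = of_real s * cinner \<xi> \<zeta>"
          using multiple[of \<eta>] split(1) False s_def by (metis cinner_scaleC_left scaleR_scaleC)
        then show False using orth[OF \<eta> \<zeta>] nonzero s by simp
      qed
      moreover have "vector_state \<zeta> \<noteq> \<omega>"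
      proof
        assume "vector_state \<zeta> = \<omega>"
        then have "cinner \<zeta> \<eta> = of_real t * cinner \<xi> \<eta>"
          using multiple[of \<zeta>] split(2) False t_def by (metis cinner_scaleC_left scaleR_scaleC)
        then show False using orth[OF \<eta> \<zeta>] nonzero t by simp
      qed
      ultimately show ?thesis
        using detectable_extreme[OF det state_vector_state state_vector_state _ _ s t st] convex False by blast
    qed
  qed
  moreover have "\<xi> \<noteq> 0" using unit by auto
  ultimately show ?thesis unfolding irreducible_rep_def by blast
qed

lemma isometry_closed_range:
  assumes "isometry V"
  shows "closed (range V)"
proof -
  have lin: "clinear V" and norm: "\<And>h. norm (V h) = norm h" using assms by (auto simp: isometry_def)
  have "complete (V ` UNIV)"
    using norm
    by (intro complete_isometric_image[of 1] clinear_bounded_linear[of V 1] lin complete_UNIV)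
      (auto simp: subspace_UNIV)
  then show ?thesis by (rule complete_imp_closed)
qed

text \<open>\<open>V \<circ> V'\<close> is the orthogonal projection onto the range of \<open>V\<close>, and a projection that does
  not shorten \<open>k\<close> fixes \<open>k\<close>.\<close>

lemma isometry_adjoint_eq_if_norm_eq:
  assumes V: "isometry V" and adj: "adjoint_pair V V'" and eq: "norm (V' k) = norm k"
  shows "V (V' k) = k"
proof -
  have "cinner k (V (V' k)) = cinner (V' k) (V' k)"
    using adj unfolding adjoint_pair_def by (metis cinner_commute)
  then have "(norm (k - V (V' k)))\<^sup>2 = 0"
    using V eq by (simp add: norm_diff_square isometry_def cinner_norm)
  then show ?thesis by simp
qed

text \<open>If the compression of \<open>\<pi>\<close> is itself multiplicative, then \<open>\<pi> b (V h)\<close> and its compression \<open>\<sigma> b h\<close>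
  both have squared norm \<open>cinner (\<sigma> (star b * b) h) h\<close>, so \<open>\<pi> b (V h)\<close> lies in the range of \<open>V\<close>,
  and \<open>V\<close> is the required unitary onto a reducing subspace.\<close>

lemma subrepresentation_of_stinespring_representation:
  assumes \<sigma>: "unital_star_rep \<sigma>" and "stinespring_representation \<sigma> \<pi>"
  shows "subrepresentation \<sigma> \<pi>"
proof -
  obtain V V' where \<pi>: "unital_star_rep \<pi>" and V: "isometry V" and adj: "adjoint_pair V V'"
    and dil: "\<And>b. \<sigma> b = V' \<circ> \<pi> b \<circ> V"
    using assms(2) by (auto simp: stinespring_representation_def)
  have adj': "cinner (V x) y = cinner x (V' y)" for x y using adj by (simp add: adjoint_pair_def)
  have "norm (V' (\<pi> b (V h))) = norm (\<pi> b (V h))" for b h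
  proof -
    have "(norm (V' (\<pi> b (V h))))\<^sup>2 = Re (cinner (\<sigma> (star b * b) h) h)"
      using star_rep_norm_square[OF \<sigma>, of b h] by (simp add: dil)
    also have "\<dots> = Re (cinner (\<pi> (star b * b) (V h)) (V h))"
      by (subst (1 2) cinner_commute) (simp add: dil adj')
    also have "\<dots> = (norm (\<pi> b (V h)))\<^sup>2" by (rule star_rep_norm_square[OF \<pi>, symmetric])
    finally show ?thesis by (simp add: power2_eq_iff_nonneg)
  qed
  then have inter: "V (\<sigma> b h) = \<pi> b (V h)" for b h
    using isometry_adjoint_eq_if_norm_eq[OF V adj] by (simp add: dil)
  have "reducing_subspace \<pi> (range V)" unfolding reducing_subspace_def
  proof (intro conjI allI)
    have lin: "clinear V" using V by (simp add: isometry_def)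
    show "csubspace (range V)" unfolding csubspace_def
      using clinear_zero[OF lin]
      by (auto simp flip: clinear_add[OF lin] clinear_scaleC[OF lin] intro: rev_image_eqI)
    show "closed (range V)" by (rule isometry_closed_range[OF V])
    show "\<pi> b ` range V \<subseteq> range V" for b by (auto simp flip: inter)
    show "\<pi> b ` orthogonal_complement (range V) \<subseteq> orthogonal_complement (range V)" for b
      by (auto simp: orthogonal_complement_def star_rep_adjoint[OF \<pi>] simp flip: inter)
  qed
  then show ?thesis unfolding subrepresentation_def using V inter by (auto simp: fun_eq_iff)
qed

theorem theorem7p10:
  fixes M :: "'b::unital_cstar_algebra set"
    and \<omega> :: "'b \<Rightarrow> complex"
    and \<sigma> :: "'b \<Rightarrow> 'h::chilbert_space \<Rightarrow> 'h"
  assumes "unital_subspace M"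
    and "cstar_generated M = UNIV"
    and "state \<omega>"
    and "detectable TYPE('i) M \<omega>"
    and "gns_representation \<omega> \<sigma>"
  shows "(\<forall>\<theta> :: 'b \<Rightarrow> 'h \<Rightarrow> 'h. ucp \<theta> \<and> (\<forall>x\<in>M. \<theta> x = \<sigma> x) \<longrightarrow>
           (\<forall>\<pi> :: 'b \<Rightarrow> 'k::chilbert_space \<Rightarrow> 'k.
              stinespring_representation \<theta> \<pi> \<longrightarrow> subrepresentation \<sigma> \<pi>))
         \<and> boundary_representation M \<sigma>"
proof -
  have \<sigma>: "unital_star_rep \<sigma>" using assms(5) by (simp add: gns_representation_def)
  have unique: "\<theta> = \<sigma>" if "ucp \<theta>" "\<forall>x\<in>M. \<theta> x = \<sigma> x" for \<theta>
    using detectable_gns_unique_extension[OF assms(2-5)] that by blast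
  moreover have "irreducible_rep \<sigma>" by (rule detectable_gns_irreducible[OF assms(3-5)])
  ultimately show ?thesis
    using \<sigma> subrepresentation_of_stinespring_representation[OF \<sigma>]
    unfolding boundary_representation_def unique_extension_property_def by blast
qed

end
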